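(* Let $F$ be a set of clauses, $n=|\mathrm{var}(F)|$, and let $C$ be a clause. Suppose $G$ is a resolution dag proof of $C$ from $F$ of size $s$. Then there is a regWRTI proof $T$ of $C$ from $\mathrm{VE}(F)$ of size at most $2s\cdot(d+2)+1$, where $d=\max\{|D|: D\text{ a clause in }G\}\le n$.
   Context: Clauses are finite sets of literals. For a set $F$ of clauses with $|\mathrm{var}(F)|=n$, let $q,p_1,\dots,p_n$ be new variables; the variable extension of $F$ is $\mathrm{VE}(F)=F\cup\{\{q,\overline l\}: l\in C\in F\}\cup\{\{p_1,\dots,p_n\}\}$. Resolution: from $C_0\ni x$, $C_1\ni\overline x$ infer $(C_0\setminus\{x\})\cup(C_1\setminus\{\overline x\})$; w-resolution: the same inference from arbitrary $C_0,C_1$ and a variable $x$. A resolution dag (RD) proof of $C$ from $F$: a finite dag of clause-labeled nodes with a unique out-degree-$0$ node labeled $C$, in-degree-$0$ nodes labeled by clauses of $F$, every other node of in-degree $2$ labeled by a variable $x$ and the resolvent on $x$ of its predecessors' clauses. A regWRTI proof of $C$ from a set $F'$ of clauses: an ordered binary tree $T$ with post-order $<_T$ (left subtree, then right subtree, then the node) where each leaf $v$ is labeled by a clause of $F'$ or by the clause of some input-derived node $u<_T v$, each internal node by a variable $x$ and the w-resolvent on $x$ of its children's clauses, the root by $C$, and no leaf-to-root path contains two inferences on the same variable; a node is input-derived if its subtree is an input resolution tree (only genuine resolution inferences, every internal node having a leaf child). Size = number of nodes.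
   Formalization: The clauses of F are assumed non-tautological (for F={{a,¬a,l},{a},{¬a}}, C={l} the claim fails), and d ≤ n is asserted only when no clause in G is tautological (it fails otherwise); the size bound still allows tautological derived clauses in G. *)

theory Defs
  imports "Graph_Theory.Digraph"
begin

datatype 'v lit = Pos 'v | Neg 'v

primrec var_of :: "'v lit \<Rightarrow> 'v" where
  "var_of (Pos x) = x"
| "var_of (Neg x) = x"

primrec compl :: "'v lit \<Rightarrow> 'v lit" where
  "compl (Pos x) = Neg x"
| "compl (Neg x) = Pos x"

text \<open>Finiteness of clauses is imposed where clauses are given (on the members of \<open>F\<close>);
  all the inferences below preserve it.\<close>

type_synonym 'v clause = "'v lit set"

definition vars :: "'v clause set \<Rightarrow> 'v set" where
  "vars F = {var_of l | l E. l \<in> E \<and> E \<in> F}"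

definition tautological :: "'v clause \<Rightarrow> bool" where
  "tautological E \<longleftrightarrow> (\<exists>x. Pos x \<in> E \<and> Neg x \<in> E)"

definition VE :: "'v clause set \<Rightarrow> 'v \<Rightarrow> 'v list \<Rightarrow> 'v clause set" where
  "VE F q ps = F \<union> {{Pos q, compl l} | l E. l \<in> E \<and> E \<in> F} \<union> {Pos ` set ps}"

definition fresh_vars :: "'v clause set \<Rightarrow> 'v \<Rightarrow> 'v list \<Rightarrow> bool" where
  "fresh_vars F q ps \<longleftrightarrow>
     length ps = card (vars F) \<and> distinct (q # ps) \<and> set (q # ps) \<inter> vars F = {}"

text \<open>Either premise may play the role of the one that loses the positive literal, so
  the order of the premises carries no meaning.\<close>

definition w_resolvent :: "'v \<Rightarrow> 'v clause \<Rightarrow> 'v clause \<Rightarrow> 'v clause \<Rightarrow> bool" where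
  "w_resolvent x A B D \<longleftrightarrow>
     D = (A - {Pos x}) \<union> (B - {Neg x}) \<or> D = (B - {Pos x}) \<union> (A - {Neg x})"

definition resolvent :: "'v \<Rightarrow> 'v clause \<Rightarrow> 'v clause \<Rightarrow> 'v clause \<Rightarrow> bool" where
  "resolvent x A B D \<longleftrightarrow>
     Pos x \<in> A \<and> Neg x \<in> B \<and> D = (A - {Pos x}) \<union> (B - {Neg x}) \<or>
     Pos x \<in> B \<and> Neg x \<in> A \<and> D = (B - {Pos x}) \<union> (A - {Neg x})"

text \<open>Arcs point from premises to conclusions. A node is labeled by the clause \<open>cl v\<close>
  and, if it is not a source, by the variable \<open>xv v\<close>; \<open>xv\<close> is irrelevant on sources.\<close>

definition rd_proof ::
  "'v clause set \<Rightarrow> ('n, 'a) pre_digraph \<Rightarrow> ('n \<Rightarrow> 'v clause) \<Rightarrow> ('n \<Rightarrow> 'v) \<Rightarrow> 'v clause \<Rightarrow> bool"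
where
  "rd_proof F G cl xv C \<longleftrightarrow>
     fin_digraph G \<and> acyclic (arcs_ends G) \<and>
     (\<exists>r. {v \<in> verts G. out_degree G v = 0} = {r} \<and> cl r = C) \<and>
     (\<forall>v \<in> verts G.
        if in_degree G v = 0 then cl v \<in> F
        else in_degree G v = 2 \<and>
          (\<exists>a b. in_arcs G v = {a, b} \<and> resolvent (xv v) (cl (tail G a)) (cl (tail G b)) (cl v)))"

text \<open>Ordered binary trees: a leaf carries its clause, an inner node its clause, the variable of
  the inference, and its left and right subtrees.\<close>

datatype 'v rtree = Leaf "'v clause" | Node "'v clause" 'v "'v rtree" "'v rtree"

primrec root_clause :: "'v rtree \<Rightarrow> 'v clause" where
  "root_clause (Leaf D) = D"
| "root_clause (Node D x l r) = D"

primrec is_leaf :: "'v rtree \<Rightarrow> bool" where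
  "is_leaf (Leaf D) = True"
| "is_leaf (Node D x l r) = False"

text \<open>The nodes in post-order, each one represented by its subtree; distinct nodes with equal
  subtrees are told apart by their position in the list.\<close>

primrec postorder :: "'v rtree \<Rightarrow> 'v rtree list" where
  "postorder (Leaf D) = [Leaf D]"
| "postorder (Node D x l r) = postorder l @ postorder r @ [Node D x l r]"

definition num_nodes :: "'v rtree \<Rightarrow> nat" where
  "num_nodes T = length (postorder T)"

text \<open>The sequences of inference variables along the paths between the root and the leaves.\<close>

primrec branches :: "'v rtree \<Rightarrow> 'v list set" where
  "branches (Leaf D) = {[]}"
| "branches (Node D x l r) = (#) x ` (branches l \<union> branches r)"

primrec input_tree :: "'v rtree \<Rightarrow> bool" where
  "input_tree (Leaf D) \<longleftrightarrow> True"
| "input_tree (Node D x l r) \<longleftrightarrow>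
     (is_leaf l \<or> is_leaf r) \<and> resolvent x (root_clause l) (root_clause r) D \<and>
     input_tree l \<and> input_tree r"

definition regWRTI_proof :: "'v clause set \<Rightarrow> 'v rtree \<Rightarrow> 'v clause \<Rightarrow> bool" where
  "regWRTI_proof F T C \<longleftrightarrow>
     root_clause T = C \<and>
     (\<forall>i < length (postorder T). \<forall>D. postorder T ! i = Leaf D \<longrightarrow>
        D \<in> F \<or> (\<exists>j < i. input_tree (postorder T ! j) \<and> root_clause (postorder T ! j) = D)) \<and>
     (\<forall>D x l r. Node D x l r \<in> set (postorder T) \<longrightarrow>
        w_resolvent x (root_clause l) (root_clause r) D) \<and>
     (\<forall>p \<in> branches T. distinct p)"

end

theory Submission
  imports Defs
begin

text \<open>Resolving with the clauses \<open>{q, compl l}\<close> strips literals at the cost of a single \<open>q\<close>.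
  If \<open>G\<close> has at most \<open>2 ^ n\<close> nodes, each node contributes a block: an input resolution of
  its clause from earlier lemmas, followed by stripping all literals outside \<open>C\<close>. The blocks
  are joined, in topological order, by w-resolutions on \<open>p\<^sub>1, \<dots>, p\<^sub>n\<close>, which only form
  unions. A last inference on \<open>q\<close> with a lemma contained in \<open>C\<close> yields \<open>C\<close>; the stripped
  source clauses supply the literals that this lemma lacks. If \<open>G\<close> has more than \<open>2 ^ n\<close>
  nodes, a complete search tree over the variables of \<open>F\<close> is small enough to replace the
  lemmas.\<close>

section \<open>Regular trees relative to a set of available clauses\<close>

text \<open>These are the lemmas that a finished subtree offers to everything after it in
  post-order. Recording clauses instead of positions makes the leaf condition structural.\<close>

definition input_derived :: "'v rtree \<Rightarrow> 'v clause set" where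
  "input_derived t = root_clause ` {u \<in> set (postorder t). input_tree u}"

text \<open>\<open>S\<close> holds the clauses available as leaves and \<open>V\<close> the variables not yet used on the
  path from the root.\<close>

primrec reg_tree :: "'v clause set \<Rightarrow> 'v set \<Rightarrow> 'v rtree \<Rightarrow> bool" where
  "reg_tree S V (Leaf D) \<longleftrightarrow> D \<in> S"
| "reg_tree S V (Node D x l r) \<longleftrightarrow>
     x \<in> V \<and> w_resolvent x (root_clause l) (root_clause r) D \<and>
     reg_tree S (V - {x}) l \<and> reg_tree (S \<union> input_derived l) (V - {x}) r"

primrec reg_trees :: "'v clause set \<Rightarrow> 'v set \<Rightarrow> 'v rtree list \<Rightarrow> bool" where
  "reg_trees S V [] \<longleftrightarrow> True"
| "reg_trees S V (t # ts) \<longleftrightarrow> reg_tree S V t \<and> reg_trees (S \<union> input_derived t) V ts"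

lemma num_nodes_simps [simp]:
  "num_nodes (Leaf D) = 1"
  "num_nodes (Node D x l r) = num_nodes l + num_nodes r + 1"
  by (auto simp: num_nodes_def)

lemma input_derived_Node:
  "input_derived l \<union> input_derived r \<subseteq> input_derived (Node D x l r)"
  by (auto simp: input_derived_def)

lemma input_derived_input_tree:
  assumes "input_tree t"
  shows "root_clause t \<in> input_derived t"
proof -
  have "t \<in> set (postorder t)" by (cases t) auto
  then show ?thesis using assms by (auto simp: input_derived_def)
qed

lemma reg_tree_mono:
  "reg_tree S V t \<Longrightarrow> S \<subseteq> S' \<Longrightarrow> V \<subseteq> V' \<Longrightarrow> reg_tree S' V' t"
proof (induction t arbitrary: S S' V V')
  case (Node D x l r)
  have "reg_tree S' (V' - {x}) l"
    by (rule Node.IH(1)[of S "V - {x}"]) (use Node.prems in auto)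
  moreover have "reg_tree (S' \<union> input_derived l) (V' - {x}) r"
    by (rule Node.IH(2)[of "S \<union> input_derived l" "V - {x}"]) (use Node.prems in auto)
  ultimately show ?case using Node.prems by auto
qed auto

lemma reg_trees_mono:
  "reg_trees S V ts \<Longrightarrow> S \<subseteq> S' \<Longrightarrow> reg_trees S' V ts"
proof (induction ts arbitrary: S S')
  case (Cons t ts)
  have "reg_trees (S' \<union> input_derived t) V ts"
    by (rule Cons.IH[of "S \<union> input_derived t"]) (use Cons.prems in auto)
  then show ?case using Cons.prems reg_tree_mono[of S V t S' V] by auto
qed auto

lemma reg_trees_append:
  "reg_trees S V (ts @ us) \<longleftrightarrow>
     reg_trees S V ts \<and> reg_trees (S \<union> \<Union> (input_derived ` set ts)) V us"
  by (induction ts arbitrary: S) (auto simp: Un_assoc)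

text \<open>\<open>S\<close> grows only on entering a right subtree, by lemmas of the left sibling.
  The post-order of the left subtree precedes that of the right one, so every lemma used has a
  smaller index than the leaf using it.\<close>

lemma reg_tree_leaves:
  assumes "reg_tree S V t" "i < length (postorder t)" "postorder t ! i = Leaf D"
  shows "D \<in> S \<or> (\<exists>j<i. input_tree (postorder t ! j) \<and> root_clause (postorder t ! j) = D)"
  using assms
proof (induction t arbitrary: S V i)
  case (Node E x l r)
  let ?P = "postorder (Node E x l r)" and ?m = "length (postorder l)"
  have left: "?P ! j = postorder l ! j" if "j < ?m" for j
    using that by (simp add: nth_append)
  have right: "?P ! (?m + j) = postorder r ! j" if "j < length (postorder r)" for j
    using that by (simp add: nth_append)
  consider "i < ?m" | j where "i = ?m + j" "j < length (postorder r)"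
    | "i = ?m + length (postorder r)"
    using Node.prems(2)
    by simp (metis add_diff_inverse_nat less_SucE nat_add_left_cancel_less)
  then show ?case
  proof cases
    case 1
    have "D \<in> S \<or> (\<exists>j<i. input_tree (postorder l ! j) \<and> root_clause (postorder l ! j) = D)"
      by (rule Node.IH(1)[where V = "V - {x}"]) (use Node.prems left[OF 1] 1 in auto)
    then show ?thesis using left 1 by (metis less_trans)
  next
    case (2 j)
    have "D \<in> S \<union> input_derived l \<or>
        (\<exists>k<j. input_tree (postorder r ! k) \<and> root_clause (postorder r ! k) = D)"
      by (rule Node.IH(2)[where V = "V - {x}"]) (use Node.prems right[of j] 2 in auto)
    then consider "D \<in> S" | "D \<in> input_derived l"
      | k where "k < j" "input_tree (postorder r ! k)" "root_clause (postorder r ! k) = D"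
      by auto
    then show ?thesis
    proof cases
      case 1
      then show ?thesis by simp
    next
      case b: 2
      then obtain k where "k < ?m" "input_tree (postorder l ! k)"
          "root_clause (postorder l ! k) = D"
        by (auto simp: input_derived_def in_set_conv_nth)
      then show ?thesis using left 2 by (metis trans_less_add1)
    next
      case 3
      then show ?thesis using right[of k] 2 by (intro disjI2 exI[of _ "?m + k"]) auto
    qed
  next
    case 3
    then have "?P ! i = Node E x l r" by (simp add: nth_append)
    then show ?thesis using Node.prems by simp
  qed
qed auto

lemma reg_tree_w_resolvent:
  "reg_tree S V t \<Longrightarrow> Node D x l r \<in> set (postorder t) \<Longrightarrow>
     w_resolvent x (root_clause l) (root_clause r) D"
  by (induction t arbitrary: S V) auto

lemma reg_tree_branches:
  "reg_tree S V t \<Longrightarrow> p \<in> branches t \<Longrightarrow> distinct p \<and> set p \<subseteq> V"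
proof (induction t arbitrary: S V p)
  case (Node D x l r)
  then obtain p' where p: "p = x # p'" "p' \<in> branches l \<or> p' \<in> branches r" by auto
  then have "distinct p' \<and> set p' \<subseteq> V - {x}"
    using Node.prems Node.IH(1)[of S "V - {x}" p']
      Node.IH(2)[of "S \<union> input_derived l" "V - {x}" p'] by auto
  then show ?case using p Node.prems by auto
qed auto

text \<open>From here on trees are built through \<open>reg_tree\<close> only, and positions in the
  post-order no longer occur.\<close>

lemma reg_tree_regWRTI:
  assumes "reg_tree S V t"
  shows "regWRTI_proof S t (root_clause t)"
  unfolding regWRTI_proof_def
  using reg_tree_leaves[OF assms] reg_tree_w_resolvent[OF assms] reg_tree_branches[OF assms]
  by blast

section \<open>Stripping literals and joining trees\<close>

text \<open>Each literal costs one inference and one leaf. The inferences sit above \<open>t\<close>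
  on variables that are distinct and outside \<open>V\<close>, which keeps the tree regular. The
  root is only enclosed between two sets because \<open>Pos q\<close> need not appear when
  \<open>ls\<close> is empty.\<close>

lemma strip_literals:
  assumes "reg_tree S V t" "distinct (map var_of ls)" "var_of ` set ls \<inter> V = {}"
    and "q \<notin> var_of ` set ls" "\<And>l. l \<in> set ls \<Longrightarrow> {Pos q, compl l} \<in> S"
  shows "\<exists>t'. reg_tree S (V \<union> var_of ` set ls) t' \<and> input_derived t \<subseteq> input_derived t' \<and>
    num_nodes t' = num_nodes t + 2 * length ls \<and>
    root_clause t - set ls \<subseteq> root_clause t' \<and>
    root_clause t' \<subseteq> (root_clause t - set ls) \<union> {Pos q}"
  using assms(2-5)
proof (induction ls)
  case Nil
  then show ?case using assms(1) by auto
next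
  case (Cons l ls)
  then obtain t' where t': "reg_tree S (V \<union> var_of ` set ls) t'"
    "input_derived t \<subseteq> input_derived t'" "num_nodes t' = num_nodes t + 2 * length ls"
    "root_clause t - set ls \<subseteq> root_clause t'"
    "root_clause t' \<subseteq> (root_clause t - set ls) \<union> {Pos q}"
    by auto
  let ?L = "Leaf {Pos q, compl l}"
  let ?t = "Node ((root_clause t' - {l}) \<union> {Pos q}) (var_of l) t' ?L"
  have "w_resolvent (var_of l) (root_clause t') (root_clause ?L) (root_clause ?t)"
    using Cons.prems by (cases l) (auto simp: w_resolvent_def)
  moreover have "V \<union> var_of ` set ls \<subseteq> (V \<union> var_of ` set (l # ls)) - {var_of l}"
    using Cons.prems by auto
  then have "reg_tree S ((V \<union> var_of ` set (l # ls)) - {var_of l}) t'"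
    using t'(1) reg_tree_mono by blast
  ultimately have "reg_tree S (V \<union> var_of ` set (l # ls)) ?t"
    using Cons.prems by auto
  moreover have "input_derived t \<subseteq> input_derived ?t"
    using t'(2) input_derived_Node by fast
  moreover have "l \<noteq> Pos q" using Cons.prems by auto
  ultimately show ?case using t'(3-5) by (intro exI[of _ ?t]) auto
qed

text \<open>The joining nodes form a binary tree with one level per variable of \<open>ps\<close>,
  so \<open>2 ^ length ps\<close> trees fit and no path repeats a variable. Keeping the order of
  \<open>ts\<close> lets later trees use lemmas of earlier ones. Joining \<open>k\<close> trees
  takes \<open>k - 1\<close> nodes, whence the \<open>+ 1\<close> on both sides of the size
  equation.\<close>

lemma combine_trees:
  assumes "ts \<noteq> []" "length ts \<le> 2 ^ length ps" "distinct ps" "V \<inter> set ps = {}"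
    and "reg_trees S V ts" "\<And>t. t \<in> set ts \<Longrightarrow> var_of ` root_clause t \<inter> set ps = {}"
  shows "\<exists>t. reg_tree S (V \<union> set ps) t \<and> \<Union> (input_derived ` set ts) \<subseteq> input_derived t \<and>
    num_nodes t + 1 = (\<Sum>u\<leftarrow>ts. num_nodes u + 1) \<and>
    root_clause t = \<Union> (root_clause ` set ts)"
  using assms
proof (induction ps arbitrary: ts S)
  case Nil
  then obtain t where "ts = [t]" by (cases ts) auto
  then show ?case using Nil by auto
next
  case (Cons p ps)
  have ps: "distinct ps" "V \<inter> set ps = {}" using Cons.prems(3,4) by auto
  have fresh: "var_of ` root_clause t \<inter> set ps = {}" if "t \<in> set ts" for t
    using Cons.prems(6)[OF that] by auto
  show ?case
  proof (cases "length ts \<le> 2 ^ length ps")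
    case True
    then obtain t where t: "reg_tree S (V \<union> set ps) t"
        "\<Union> (input_derived ` set ts) \<subseteq> input_derived t"
        "num_nodes t + 1 = (\<Sum>u\<leftarrow>ts. num_nodes u + 1)"
        "root_clause t = \<Union> (root_clause ` set ts)"
      using Cons.IH[OF Cons.prems(1) True ps Cons.prems(5) fresh] by blast
    have "reg_tree S (V \<union> set (p # ps)) t" by (rule reg_tree_mono[OF t(1)]) auto
    then show ?thesis using t by blast
  next
    case False
    \<comment> \<open>The left half is filled completely. Both halves may use the same variables
      \<open>ps\<close>, since they lie on different branches.\<close>
    define us vs where "us = take (2 ^ length ps) ts" and "vs = drop (2 ^ length ps) ts"
    have ts: "ts = us @ vs" by (simp add: us_def vs_def)
    have len: "us \<noteq> []" "length us \<le> 2 ^ length ps" "vs \<noteq> []" "length vs \<le> 2 ^ length ps"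
      using False Cons.prems(1,2) by (auto simp: us_def vs_def)
    have reg: "reg_trees S V us" "reg_trees (S \<union> \<Union> (input_derived ` set us)) V vs"
      using Cons.prems(5) by (simp_all add: ts reg_trees_append)
    have fresh_us: "\<And>t. t \<in> set us \<Longrightarrow> var_of ` root_clause t \<inter> set ps = {}"
      and fresh_vs: "\<And>t. t \<in> set vs \<Longrightarrow> var_of ` root_clause t \<inter> set ps = {}"
      using fresh by (simp_all add: ts)
    have fresh_p: "Pos p \<notin> root_clause t" "Neg p \<notin> root_clause t"
      if "t \<in> set us \<union> set vs" for t
      using Cons.prems(6)[of t] that unfolding ts by force+
    obtain l where l: "reg_tree S (V \<union> set ps) l"
        "\<Union> (input_derived ` set us) \<subseteq> input_derived l"
        "num_nodes l + 1 = (\<Sum>u\<leftarrow>us. num_nodes u + 1)"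
        "root_clause l = \<Union> (root_clause ` set us)"
      using Cons.IH[OF len(1,2) ps reg(1) fresh_us] by blast
    have reg_vs: "reg_trees (S \<union> input_derived l) V vs"
      by (rule reg_trees_mono[OF reg(2)]) (use l(2) in auto)
    obtain r where r: "reg_tree (S \<union> input_derived l) (V \<union> set ps) r"
        "\<Union> (input_derived ` set vs) \<subseteq> input_derived r"
        "num_nodes r + 1 = (\<Sum>u\<leftarrow>vs. num_nodes u + 1)"
        "root_clause r = \<Union> (root_clause ` set vs)"
      using Cons.IH[OF len(3,4) ps reg_vs fresh_vs] by blast
    let ?t = "Node (root_clause l \<union> root_clause r) p l r"
    have "Pos p \<notin> root_clause l \<union> root_clause r" "Neg p \<notin> root_clause l \<union> root_clause r"
      using fresh_p unfolding l(4) r(4) by auto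
    then have "w_resolvent p (root_clause l) (root_clause r) (root_clause l \<union> root_clause r)"
      by (auto simp: w_resolvent_def)
    moreover have "V \<union> set (p # ps) - {p} = V \<union> set ps" using Cons.prems(3,4) by auto
    ultimately have "reg_tree S (V \<union> set (p # ps)) ?t" using l(1) r(1) by simp
    moreover have "\<Union> (input_derived ` set ts) \<subseteq> input_derived ?t"
      using Un_mono[OF l(2) r(2)] input_derived_Node
      unfolding ts set_append image_Un Union_Un_distrib by (rule order_trans)
    moreover have "root_clause ?t = \<Union> (root_clause ` set ts)"
      unfolding ts by (simp add: l(4) r(4))
    moreover have "num_nodes ?t + 1 = (\<Sum>u\<leftarrow>ts. num_nodes u + 1)"
      unfolding ts using l(3) r(3) by simp
    ultimately show ?thesis by blast
  qed
qed

text \<open>The right premise is free of \<open>q\<close> while the left one covers \<open>C\<close>, so the last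
  inference removes \<open>q\<close> and yields exactly \<open>C\<close>.\<close>

lemma finish_proof:
  assumes "length ts \<le> 2 ^ length ps" "distinct (q # ps)" "V \<inter> set (q # ps) = {}"
    and "var_of ` C \<subseteq> V" "reg_trees S V ts"
    and "\<And>t. t \<in> set ts \<Longrightarrow> root_clause t \<subseteq> C \<union> {Pos q}"
    and "C \<subseteq> \<Union> (root_clause ` set ts)"
    and "reg_tree (S \<union> \<Union> (input_derived ` set ts)) V t" "root_clause t \<subseteq> C"
  shows "\<exists>T. regWRTI_proof S T C \<and> num_nodes T \<le> (\<Sum>u\<leftarrow>ts. num_nodes u + 1) + num_nodes t"
proof (cases "ts = []")
  \<comment> \<open>Here \<open>C\<close> is empty, so \<open>t\<close> alone is a proof of
    \<open>C\<close>.\<close>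
  case True
  then show ?thesis using assms(7-9) reg_tree_regWRTI[of S V t] by auto
next
  case False
  have "var_of ` root_clause u \<inter> set ps = {}" if "u \<in> set ts" for u
    using assms(2,3,4) assms(6)[OF that] by fastforce
  then obtain l where l: "reg_tree S (V \<union> set ps) l"
      "\<Union> (input_derived ` set ts) \<subseteq> input_derived l"
      "num_nodes l + 1 = (\<Sum>u\<leftarrow>ts. num_nodes u + 1)"
      "root_clause l = \<Union> (root_clause ` set ts)"
    using combine_trees[of ts ps V S] False assms(1,2,3,5) by auto
  have r: "reg_tree (S \<union> input_derived l) (V \<union> set ps) t"
    by (rule reg_tree_mono[OF assms(8)]) (use l(2) in auto)
  have q: "Pos q \<notin> C" "Neg q \<notin> C" using assms(3,4) by force+
  have "root_clause l \<subseteq> C \<union> {Pos q}" "C \<subseteq> root_clause l"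
    using assms(6,7) unfolding l(4) by blast+
  then have "C = (root_clause l - {Pos q}) \<union> (root_clause t - {Neg q})"
    using q assms(9) by blast
  then have "w_resolvent q (root_clause l) (root_clause t) C"
    by (simp add: w_resolvent_def)
  moreover have "V \<union> set (q # ps) - {q} = V \<union> set ps" using assms(2,3) by auto
  ultimately have "reg_tree S (V \<union> set (q # ps)) (Node C q l t)" using l(1) r by simp
  from reg_tree_regWRTI[OF this] show ?thesis
    using l(3) by (intro exI[of _ "Node C q l t"]) auto
qed

section \<open>Resolution dags and search trees\<close>

text \<open>The graph enters only through the relation of its arcs, and the premises are named so
  that \<open>a\<close> always carries the positive literal.\<close>

locale resolution_dag =
  fixes F :: "'v clause set" and N :: "'n set" and E :: "'n rel" and cl :: "'n \<Rightarrow> 'v clause"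
  assumes finite_nodes: "finite N" and E_subset: "E \<subseteq> N \<times> N" and acyclic: "acyclic E"
    and step: "v \<in> N \<Longrightarrow> cl v \<in> F \<or> (\<exists>x a b. (a, v) \<in> E \<and> (b, v) \<in> E \<and>
      Pos x \<in> cl a \<and> Neg x \<in> cl b \<and> cl v = (cl a - {Pos x}) \<union> (cl b - {Neg x}))"
begin

lemma finite_E: "finite E"
  using finite_nodes E_subset finite_subset by blast

lemma node_induct [consumes 1, case_names source inner]:
  assumes "v \<in> N"
    and source: "\<And>v. v \<in> N \<Longrightarrow> cl v \<in> F \<Longrightarrow> P v"
    and inner: "\<And>v x a b. v \<in> N \<Longrightarrow> a \<in> N \<Longrightarrow> b \<in> N \<Longrightarrow> P a \<Longrightarrow> P b \<Longrightarrow> Pos x \<in> cl a \<Longrightarrow>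
      Neg x \<in> cl b \<Longrightarrow> cl v = (cl a - {Pos x}) \<union> (cl b - {Neg x}) \<Longrightarrow> P v"
  shows "P v"
  using finite_acyclic_wf[OF finite_E acyclic] assms(1)
proof (induction v rule: wf_induct_rule)
  case (less v)
  from step[OF less.prems] show ?case
  proof
    assume "\<exists>x a b. (a, v) \<in> E \<and> (b, v) \<in> E \<and> Pos x \<in> cl a \<and> Neg x \<in> cl b \<and>
      cl v = (cl a - {Pos x}) \<union> (cl b - {Neg x})"
    then obtain x a b where *: "(a, v) \<in> E" "(b, v) \<in> E" "Pos x \<in> cl a" "Neg x \<in> cl b"
      "cl v = (cl a - {Pos x}) \<union> (cl b - {Neg x})" by blast
    then have "a \<in> N" "b \<in> N" using E_subset by auto
    then show ?thesis using inner[of v a b x] * less by blast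
  qed (use source less.prems in blast)
qed

text \<open>Resolution creates no literals. Hence \<open>VE\<close> has a stripping clause for every
  literal in the dag, and the sources together cover \<open>C\<close>.\<close>

lemma literal_from_source:
  assumes "v \<in> N" "l \<in> cl v"
  shows "\<exists>u\<in>N. cl u \<in> F \<and> l \<in> cl u"
  using assms by (induction v rule: node_induct) auto

lemma var_of_literal: "v \<in> N \<Longrightarrow> l \<in> cl v \<Longrightarrow> var_of l \<in> vars F"
  using literal_from_source unfolding vars_def by blast

text \<open>Read \<open>L\<close> as the literals falsified by an assignment. Whichever literal of
  the resolved variable lies in \<open>L\<close>, the premise containing it is again a subset of
  \<open>L\<close>, so the walk towards the sources never leaves \<open>L\<close>.\<close>

lemma source_below_total:
  assumes "v \<in> N" "cl v \<subseteq> L" "\<And>x. x \<in> vars F \<Longrightarrow> Pos x \<in> L \<or> Neg x \<in> L"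
  shows "\<exists>D\<in>F. D \<subseteq> L"
  using assms(1,2)
proof (induction v rule: node_induct)
  case (inner v x a b)
  have "x \<in> vars F" using var_of_literal[of a "Pos x"] inner by simp
  with assms(3) show ?case using inner by blast
qed auto

text \<open>Every branch adds to \<open>L\<close> one literal of each variable in \<open>xs\<close>,
  after which \<open>source_below_total\<close> supplies the leaf. W-resolution permits an inference
  on a variable missing from a premise, so the tree is complete and its size is exact.\<close>

lemma search_tree:
  assumes "v \<in> N" "cl v \<subseteq> L" "distinct xs"
    and "\<And>x. x \<in> vars F \<Longrightarrow> x \<in> set xs \<or> Pos x \<in> L \<or> Neg x \<in> L"
  shows "\<exists>t. reg_tree F (set xs) t \<and> root_clause t \<subseteq> L \<and> num_nodes t + 1 = 2 ^ (length xs + 1)"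
  using assms(2-4)
proof (induction xs arbitrary: L)
  case Nil
  then obtain D where "D \<in> F" "D \<subseteq> L" using source_below_total[OF assms(1), of L] by auto
  then show ?case by (intro exI[of _ "Leaf D"]) auto
next
  case (Cons x xs)
  obtain l where l: "reg_tree F (set xs) l" "root_clause l \<subseteq> insert (Pos x) L"
      "num_nodes l + 1 = 2 ^ (length xs + 1)"
    using Cons.IH[of "insert (Pos x) L"] Cons.prems by fastforce
  obtain r where r: "reg_tree F (set xs) r" "root_clause r \<subseteq> insert (Neg x) L"
      "num_nodes r + 1 = 2 ^ (length xs + 1)"
    using Cons.IH[of "insert (Neg x) L"] Cons.prems by fastforce
  let ?t = "Node ((root_clause l - {Pos x}) \<union> (root_clause r - {Neg x})) x l r"
  have "set (x # xs) - {x} = set xs" using Cons.prems by auto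
  moreover have "reg_tree (F \<union> input_derived l) (set xs) r"
    by (rule reg_tree_mono[OF r(1)]) auto
  ultimately have "reg_tree F (set (x # xs)) ?t" using l(1) by (simp add: w_resolvent_def)
  moreover have "root_clause ?t \<subseteq> L" using l(2) r(2) by auto
  ultimately show ?case using l(3) r(3) by (intro exI[of _ ?t]) auto
qed

end

section \<open>Clauses that can be stripped down to \<open>C\<close>\<close>

text \<open>Two complementary literals cannot both be stripped along one branch, so a clause
  containing both is harmless only if both may stay, that is, if both are in \<open>C\<close>.\<close>

definition strippable :: "'v clause \<Rightarrow> 'v clause \<Rightarrow> bool" where
  "strippable C D \<longleftrightarrow> (\<forall>y. Pos y \<in> D \<longrightarrow> Neg y \<in> D \<longrightarrow> Pos y \<in> C \<and> Neg y \<in> C)"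

lemma strippable_inj_on: "strippable C D \<Longrightarrow> inj_on var_of (D - C)"
  unfolding strippable_def inj_on_def
proof (intro ballI impI)
  fix k l
  assume "\<forall>y. Pos y \<in> D \<longrightarrow> Neg y \<in> D \<longrightarrow> Pos y \<in> C \<and> Neg y \<in> C"
    "k \<in> D - C" "l \<in> D - C" "var_of k = var_of l"
  then show "k = l" by (cases k; cases l) auto
qed

lemma strippable_subset: "strippable C D \<Longrightarrow> D' \<subseteq> D \<Longrightarrow> strippable C D'"
  unfolding strippable_def by blast

text \<open>Resolving on \<open>x\<close> with a premise containing both literals of \<open>x\<close> weakens the other
  premise.\<close>

lemma strippable_premises:
  assumes "strippable C ((A - {Pos x}) \<union> (B - {Neg x}))" "Pos x \<in> A" "Neg x \<in> B"
  shows "strippable C A \<and> strippable C B \<or>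
    strippable C B \<and> B \<subseteq> (A - {Pos x}) \<union> (B - {Neg x}) \<or>
    strippable C A \<and> A \<subseteq> (A - {Pos x}) \<union> (B - {Neg x})"
proof -
  let ?D = "(A - {Pos x}) \<union> (B - {Neg x})"
  have D: "Pos y \<in> C \<and> Neg y \<in> C" if "Pos y \<in> ?D" "Neg y \<in> ?D" for y
    using assms(1) that by (simp only: strippable_def)
  have A: "strippable C A" if "Neg x \<notin> A"
    unfolding strippable_def
  proof (intro allI impI)
    fix y assume y: "Pos y \<in> A" "Neg y \<in> A"
    then have "y \<noteq> x" using that by metis
    then show "Pos y \<in> C \<and> Neg y \<in> C" using y by (intro D) auto
  qed
  have B: "strippable C B" if "Pos x \<notin> B"
    unfolding strippable_def
  proof (intro allI impI)
    fix y assume y: "Pos y \<in> B" "Neg y \<in> B"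
    then have "y \<noteq> x" using that by metis
    then show "Pos y \<in> C \<and> Neg y \<in> C" using y by (intro D) auto
  qed
  consider "Neg x \<notin> A" "Pos x \<notin> B" | "B \<subseteq> ?D" | "A \<subseteq> ?D" by auto
  then show ?thesis
    using A B strippable_subset[OF assms(1)] by cases simp_all
qed

section \<open>Blocks for the nodes of the dag\<close>

locale proof_setup = resolution_dag F N E cl
  for F :: "'v clause set" and N :: "'n set" and E and cl +
  fixes q :: 'v and ps :: "'v list" and root :: 'n and C and d :: nat
  assumes finite_F: "finite F" and finite_clauses: "D \<in> F \<Longrightarrow> finite D"
    and nontaut: "D \<in> F \<Longrightarrow> \<not> tautological D"
    and fresh: "fresh_vars F q ps"
    and root: "root \<in> N" "cl root = C"
    and width: "v \<in> N \<Longrightarrow> card (cl v) \<le> d"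
begin

abbreviation "V \<equiv> vars F"
abbreviation "S \<equiv> VE F q ps"

lemma finite_V: "finite V"
proof -
  have "V = (\<Union>D\<in>F. var_of ` D)" by (auto simp: vars_def)
  then show ?thesis using finite_F finite_clauses by simp
qed

lemma finite_clause: "v \<in> N \<Longrightarrow> finite (cl v)"
  by (rule finite_subset[of _ "\<Union> F"])
    (use literal_from_source finite_F finite_clauses in blast, use finite_F finite_clauses in blast)

lemma q_notin: "q \<notin> V"
  using fresh by (auto simp: fresh_vars_def)

lemma F_subset: "F \<subseteq> S"
  by (auto simp: VE_def)

lemma VE_literal: "v \<in> N \<Longrightarrow> l \<in> cl v \<Longrightarrow> {Pos q, compl l} \<in> S"
  using literal_from_source[of v l] by (auto simp: VE_def)

lemma var_of_C: "var_of ` C \<subseteq> V"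
  using var_of_literal root by auto

text \<open>\<open>W\<close> contains the variables already resolved on inside \<open>t\<close>:
  none for a leaf, one for a single resolution. The last hypothesis prevents stripping from
  repeating them. At most \<open>d\<close> literals are stripped because the root lies within
  \<open>cl v\<close>.\<close>

lemma strip_block:
  assumes "reg_tree S' W t" "S \<subseteq> S'" "W \<subseteq> V" "v \<in> N" "root_clause t \<subseteq> cl v"
    and "strippable C (root_clause t)" "W \<inter> var_of ` (root_clause t - C) = {}"
  shows "\<exists>t'. reg_tree S' V t' \<and> input_derived t \<subseteq> input_derived t' \<and>
    num_nodes t' \<le> num_nodes t + 2 * d \<and>
    root_clause t \<inter> C \<subseteq> root_clause t' \<and> root_clause t' \<subseteq> C \<union> {Pos q}"
proof -
  have fin: "finite (root_clause t)" using finite_clause assms(4,5) finite_subset by blast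
  then obtain ls where ls: "set ls = root_clause t - C" "distinct ls"
    using finite_distinct_list[of "root_clause t - C"] by blast
  have V: "var_of ` set ls \<subseteq> V" using ls(1) assms(4,5) var_of_literal by auto
  have "card (set ls) \<le> card (cl v)"
    using ls(1) assms(4,5) finite_clause by (intro card_mono) auto
  then have len: "length ls \<le> d" using width[OF assms(4)] distinct_card[OF ls(2)] by simp
  have "distinct (map var_of ls)"
    using ls strippable_inj_on[OF assms(6)] by (simp add: distinct_map)
  moreover have "var_of ` set ls \<inter> W = {}" using ls(1) assms(7) by auto
  moreover have "q \<notin> var_of ` set ls" using V q_notin by auto
  moreover have "{Pos q, compl l} \<in> S'" if "l \<in> set ls" for l
    using that ls(1) assms(2,4,5) VE_literal by blast
  ultimately obtain t' where t': "reg_tree S' (W \<union> var_of ` set ls) t'"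
      "input_derived t \<subseteq> input_derived t'" "num_nodes t' = num_nodes t + 2 * length ls"
      "root_clause t - set ls \<subseteq> root_clause t'"
      "root_clause t' \<subseteq> (root_clause t - set ls) \<union> {Pos q}"
    using strip_literals[of S' W t ls q] assms(1) by auto
  have "reg_tree S' V t'" by (rule reg_tree_mono[OF t'(1)]) (use assms(3) V in auto)
  then show ?thesis using t' ls(1) len by (intro exI[of _ t']) auto
qed

lemma source_block:
  assumes "v \<in> N" "cl v \<in> F"
  shows "\<exists>t. reg_tree S V t \<and> num_nodes t \<le> 2 * d + 1 \<and> cl v \<inter> C \<subseteq> root_clause t \<and>
    root_clause t \<subseteq> C \<union> {Pos q}"
proof -
  have "strippable C (cl v)"
    using nontaut[OF assms(2)] by (auto simp: strippable_def tautological_def)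
  then show ?thesis
    using strip_block[of S "{}" "Leaf (cl v)" v] assms F_subset by auto
qed

lemma resolution_block:
  assumes "v \<in> N" "strippable C (cl v)" "cl v = (cl a - {Pos x}) \<union> (cl b - {Neg x})" "x \<in> V"
    and "A \<subseteq> cl a" "B \<subseteq> cl b" "strippable C A" "strippable C B"
    and "Pos x \<in> A" "Neg x \<in> B" "A \<in> S'" "B \<in> S'" "S \<subseteq> S'"
  shows "\<exists>t. reg_tree S' V t \<and> num_nodes t \<le> 2 * d + 3 \<and> root_clause t \<subseteq> C \<union> {Pos q} \<and>
    (A - {Pos x}) \<union> (B - {Neg x}) \<in> input_derived t"
proof -
  let ?D = "(A - {Pos x}) \<union> (B - {Neg x})"
  let ?t = "Node ?D x (Leaf A) (Leaf B)"
  have sub: "?D \<subseteq> cl v" using assms(3,5,6) by auto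
  have "?D \<in> input_derived ?t"
    using input_derived_input_tree[of ?t] assms(9,10) by (simp add: resolvent_def)
  moreover have "l \<in> C" if "l \<in> ?D" "var_of l = x" for l
    using assms(7-10) that unfolding strippable_def by (cases l) auto
  then have "{x} \<inter> var_of ` (?D - C) = {}" by auto
  then have "\<exists>t'. reg_tree S' V t' \<and> input_derived ?t \<subseteq> input_derived t' \<and>
    num_nodes t' \<le> num_nodes ?t + 2 * d \<and>
    root_clause ?t \<inter> C \<subseteq> root_clause t' \<and> root_clause t' \<subseteq> C \<union> {Pos q}"
    using assms sub strippable_subset[OF assms(2) sub]
    by (intro strip_block[where v = v and W = "{x}"]) (auto simp: w_resolvent_def)
  ultimately show ?thesis by auto
qed

text \<open>The invariant after processing the nodes in \<open>W\<close>. A node adds at most one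
  tree, and its lemma may be a proper subset of its clause, because literals can already be missing
  from the lemmas used as premises.\<close>

definition blocks :: "'n set \<Rightarrow> 'v rtree list \<Rightarrow> bool" where
  "blocks W ts \<longleftrightarrow> reg_trees S V ts \<and> length ts \<le> card W \<and>
     (\<forall>t\<in>set ts. num_nodes t \<le> 2 * d + 3 \<and> root_clause t \<subseteq> C \<union> {Pos q}) \<and>
     (\<forall>v\<in>W. cl v \<in> F \<longrightarrow> cl v \<inter> C \<subseteq> \<Union> (root_clause ` set ts)) \<and>
     (\<forall>v\<in>W. strippable C (cl v) \<longrightarrow> (\<exists>D \<in> S \<union> \<Union> (input_derived ` set ts). D \<subseteq> cl v))"

lemma blocks_snoc:
  assumes "blocks W ts" "finite W" "v \<notin> W" "reg_tree (S \<union> \<Union> (input_derived ` set ts)) V t"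
    and "num_nodes t \<le> 2 * d + 3" "root_clause t \<subseteq> C \<union> {Pos q}"
    and "cl v \<in> F \<Longrightarrow> cl v \<inter> C \<subseteq> root_clause t"
    and "strippable C (cl v) \<Longrightarrow> \<exists>D \<in> S \<union> input_derived t. D \<subseteq> cl v"
  shows "blocks (insert v W) (ts @ [t])"
  unfolding blocks_def
proof (intro conjI ballI impI)
  show "reg_trees S V (ts @ [t])"
    using assms(1,4) by (simp add: blocks_def reg_trees_append)
  show "length (ts @ [t]) \<le> card (insert v W)"
    using assms(1-3) by (simp add: blocks_def)
  fix u assume "u \<in> set (ts @ [t])"
  then have "u \<in> set ts \<or> u = t" by auto
  then show "num_nodes u \<le> 2 * d + 3" "root_clause u \<subseteq> C \<union> {Pos q}"
    using assms(1,5,6) unfolding blocks_def by blast+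
next
  fix w assume w: "w \<in> insert v W" "cl w \<in> F"
  show "cl w \<inter> C \<subseteq> \<Union> (root_clause ` set (ts @ [t]))"
  proof (cases "w = v")
    case True
    then show ?thesis using assms(7) w by auto
  next
    case False
    then have "cl w \<inter> C \<subseteq> \<Union> (root_clause ` set ts)"
      using assms(1) w unfolding blocks_def by blast
    then show ?thesis by auto
  qed
next
  fix w assume w: "w \<in> insert v W" "strippable C (cl w)"
  have "\<exists>D \<in> (S \<union> \<Union> (input_derived ` set ts)) \<union> (S \<union> input_derived t). D \<subseteq> cl w"
  proof (cases "w = v")
    case True
    then show ?thesis using assms(8) w by (meson UnI2)
  next
    case False
    then have "\<exists>D \<in> S \<union> \<Union> (input_derived ` set ts). D \<subseteq> cl w"
      using assms(1) w unfolding blocks_def by (metis insertE)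
    then show ?thesis by (meson UnI1)
  qed
  moreover have "(S \<union> \<Union> (input_derived ` set ts)) \<union> (S \<union> input_derived t) =
      S \<union> \<Union> (input_derived ` set (ts @ [t]))"
    by auto
  ultimately show "\<exists>D \<in> S \<union> \<Union> (input_derived ` set (ts @ [t])). D \<subseteq> cl w" by metis
qed

lemma blocks_same:
  assumes "blocks W ts" "finite W" "v \<notin> W" "cl v \<notin> F"
    and "strippable C (cl v) \<Longrightarrow> \<exists>D \<in> S \<union> \<Union> (input_derived ` set ts). D \<subseteq> cl v"
  shows "blocks (insert v W) ts"
  unfolding blocks_def
proof (intro conjI ballI impI)
  show "length ts \<le> card (insert v W)"
    using assms(1-3) by (simp add: blocks_def)
next
  fix w assume "w \<in> insert v W" "strippable C (cl w)"
  then show "\<exists>D \<in> S \<union> \<Union> (input_derived ` set ts). D \<subseteq> cl w"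
    using assms(1,5) unfolding blocks_def by (metis insertE)
qed (use assms(1,4) in \<open>auto simp: blocks_def\<close>)

text \<open>A source gets a block that supplies its literals of \<open>C\<close>. Another node gets
  a block only if its clause is strippable and no available clause lies below it.\<close>

lemma blocks_insert:
  assumes "blocks W ts" "finite W" "v \<notin> W" "v \<in> N" "\<And>u. (u, v) \<in> E \<Longrightarrow> u \<in> W"
  shows "\<exists>ts. blocks (insert v W) ts"
proof (cases "cl v \<in> F")
  case True
  then obtain t where t: "reg_tree S V t" "num_nodes t \<le> 2 * d + 1"
      "cl v \<inter> C \<subseteq> root_clause t" "root_clause t \<subseteq> C \<union> {Pos q}"
    using source_block[OF assms(4)] by blast
  have "reg_tree (S \<union> \<Union> (input_derived ` set ts)) V t"
    by (rule reg_tree_mono[OF t(1)]) auto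
  then have "blocks (insert v W) (ts @ [t])"
    using t True F_subset by (intro blocks_snoc assms) auto
  then show ?thesis by blast
next
  case source: False
  let ?S = "S \<union> \<Union> (input_derived ` set ts)"
  show ?thesis
  proof (cases "strippable C (cl v) \<longrightarrow> (\<exists>D \<in> ?S. D \<subseteq> cl v)")
    case True
    then show ?thesis using blocks_same[OF assms(1-3) source] by blast
  next
    case False
    then have v: "strippable C (cl v)" and none: "\<And>D. D \<in> ?S \<Longrightarrow> \<not> D \<subseteq> cl v" by auto
    obtain x a b where ab: "(a, v) \<in> E" "(b, v) \<in> E" "Pos x \<in> cl a" "Neg x \<in> cl b"
      and cl: "cl v = (cl a - {Pos x}) \<union> (cl b - {Neg x})"
      using step[OF assms(4)] source by blast
    have W: "a \<in> W" "b \<in> W" using ab assms(5) by auto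
    have x: "x \<in> V" using var_of_literal[of a "Pos x"] ab E_subset by auto
    have avail: "\<exists>D \<in> ?S. D \<subseteq> cl u" if "u \<in> W" "strippable C (cl u)" for u
      using assms(1) that unfolding blocks_def by blast
    \<comment> \<open>Otherwise \<open>strippable_premises\<close> gives a strippable premise
      contained in \<open>cl v\<close>. Its available subclause would then lie below
      \<open>cl v\<close>, against \<open>none\<close>.\<close>
    have str: "strippable C (cl a)" "strippable C (cl b)"
      using strippable_premises[of C "cl a" x "cl b"] v ab(3,4) none avail W
      unfolding cl[symmetric] by (meson order_trans)+
    obtain A B where AB: "A \<in> ?S" "A \<subseteq> cl a" "B \<in> ?S" "B \<subseteq> cl b"
      using avail W str by meson
    \<comment> \<open>If the resolved literal were missing, \<open>A\<close> or \<open>B\<close>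
      itself would lie below \<open>cl v\<close>. So this is a genuine resolution, as an input
      derivation requires.\<close>
    have "Pos x \<in> A" "Neg x \<in> B" using none AB cl by blast+
    then obtain t where t: "reg_tree ?S V t" "num_nodes t \<le> 2 * d + 3"
        "root_clause t \<subseteq> C \<union> {Pos q}" "(A - {Pos x}) \<union> (B - {Neg x}) \<in> input_derived t"
      using resolution_block[OF assms(4) v cl x AB(2,4) _ _ _ _ AB(1,3)]
        strippable_subset str AB by blast
    have "(A - {Pos x}) \<union> (B - {Neg x}) \<subseteq> cl v" using AB cl by auto
    then have "\<exists>D \<in> S \<union> input_derived t. D \<subseteq> cl v" using t(4) by blast
    then have "blocks (insert v W) (ts @ [t])"
      using source by (intro blocks_snoc[OF assms(1-3) t(1-3)]) auto
    then show ?thesis by blast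
  qed
qed

text \<open>Sets closed under premises play the role of initial segments of a topological
  order.\<close>

lemma ex_blocks:
  assumes "W \<subseteq> N" "\<And>u v. (u, v) \<in> E \<Longrightarrow> v \<in> W \<Longrightarrow> u \<in> W"
  shows "\<exists>ts. blocks W ts"
  using finite_subset[OF assms(1) finite_nodes] assms
proof (induction W rule: finite_psubset_induct)
  case (psubset W)
  show ?case
  proof (cases "W = {}")
    case True
    then have "blocks W []" by (simp add: blocks_def)
    then show ?thesis by blast
  next
    case False
    \<comment> \<open>A node without successors in \<open>W\<close> comes last, and removing it
      keeps \<open>W\<close> closed under premises.\<close>
    then obtain v where v: "v \<in> W" "\<And>u. (v, u) \<in> E \<Longrightarrow> u \<notin> W"
      using wfE_min[OF finite_acyclic_wf_converse[OF finite_E acyclic], of _ W]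
      by (metis converse_iff equals0I)
    have pred: "u \<in> W - {v}" if "(u, w) \<in> E" "w \<in> W" for u w
      using that psubset.prems(2) v by blast
    have "\<exists>ts. blocks (W - {v}) ts"
      using v psubset.prems(1) pred by (intro psubset.IH) auto
    then obtain ts where "blocks (W - {v}) ts" by blast
    then have "\<exists>ts. blocks (insert v (W - {v})) ts"
      using v(1) psubset.prems(1) psubset.hyps pred by (intro blocks_insert) auto
    then show ?thesis using v(1) by (simp add: insert_absorb)
  qed
qed

section \<open>Assembling the proof in the two size ranges\<close>

lemma C_covered: "l \<in> C \<Longrightarrow> \<exists>u\<in>N. cl u \<in> F \<and> l \<in> cl u \<inter> C"
  using literal_from_source[of root l] root by auto

lemma few_nodes_proof:
  assumes "card N \<le> 2 ^ card V"
  shows "\<exists>T. regWRTI_proof S T C \<and> num_nodes T \<le> 2 * card N * (d + 2) + 1"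
proof -
  obtain ts where ts: "blocks N ts" using ex_blocks[of N] E_subset by blast
  \<comment> \<open>The clause of the root is \<open>C\<close> itself, so the invariant yields a
    lemma or axiom inside \<open>C\<close>.\<close>
  have "strippable C (cl root)" using root by (simp add: strippable_def)
  then obtain D where D: "D \<in> S \<union> \<Union> (input_derived ` set ts)" "D \<subseteq> C"
    using ts root unfolding blocks_def by metis
  have "C \<subseteq> \<Union> (root_clause ` set ts)"
    using C_covered ts unfolding blocks_def by fast
  then have "\<exists>T. regWRTI_proof S T C \<and>
      num_nodes T \<le> (\<Sum>u\<leftarrow>ts. num_nodes u + 1) + num_nodes (Leaf D)"
    using ts fresh var_of_C D assms unfolding blocks_def fresh_vars_def
    by (intro finish_proof[where V = V and ps = ps and q = q]) auto
  \<comment> \<open>A block with its share of the joining nodes and the node for \<open>q\<close>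
    costs at most \<open>2 * d + 4\<close>; the leaf \<open>D\<close> is the final
    \<open>+ 1\<close> of the bound.\<close>
  moreover have "(\<Sum>u\<leftarrow>ts. num_nodes u + 1) \<le> (\<Sum>u\<leftarrow>ts. 2 * d + 4)"
    using ts unfolding blocks_def by (intro sum_list_mono) auto
  moreover have "(\<Sum>u\<leftarrow>ts. 2 * d + 4) \<le> card N * (2 * d + 4)"
    using ts unfolding blocks_def by (simp add: sum_list_triv)
  ultimately show ?thesis by (fastforce simp: algebra_simps)
qed

lemma reg_trees_of_reg_tree:
  assumes "\<And>t. t \<in> set ts \<Longrightarrow> reg_tree S V t" "S \<subseteq> S'"
  shows "reg_trees S' V ts"
  using assms
proof (induction ts arbitrary: S')
  case (Cons t ts)
  have "reg_trees (S' \<union> input_derived t) V ts" by (rule Cons.IH) (use Cons.prems in auto)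
  then show ?case using Cons.prems reg_tree_mono[of S V t S' V] by auto
qed auto

lemma double_le_power: "2 * k \<le> 2 ^ k" for k :: nat
proof (induction k)
  case (Suc k)
  then show ?case by (cases k) auto
qed simp

text \<open>The search tree derives a subclause of \<open>C\<close>, so blocks are needed only to
  supply the literals of \<open>C\<close>, one source each. There are at most
  \<open>2 * card V\<close> of them, few enough to be joined by \<open>ps\<close>.\<close>

lemma many_nodes_proof:
  assumes "2 ^ card V < card N"
  shows "\<exists>T. regWRTI_proof S T C \<and> num_nodes T \<le> 2 * card N * (d + 2) + 1"
proof -
  obtain xs where xs: "set xs = V" "distinct xs" using finite_V finite_distinct_list by blast
  have "\<exists>t. reg_tree F (set xs) t \<and> root_clause t \<subseteq> C \<and> num_nodes t + 1 = 2 ^ (length xs + 1)"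
    by (rule search_tree[OF root(1) _ xs(2)]) (use root xs in auto)
  then obtain t where t: "reg_tree F V t" "root_clause t \<subseteq> C"
      "num_nodes t + 1 = 2 ^ (card V + 1)"
    using xs distinct_card[OF xs(2)] by metis
  have fin: "finite C" using finite_clause root by auto
  have "C \<subseteq> Pos ` V \<union> Neg ` V"
  proof
    fix l assume "l \<in> C"
    then have "var_of l \<in> V" using var_of_C by auto
    then show "l \<in> Pos ` V \<union> Neg ` V" by (cases l) auto
  qed
  then have "card C \<le> card (Pos ` V \<union> Neg ` V)" using finite_V by (intro card_mono) auto
  also have "\<dots> \<le> 2 * card V"
    using card_Un_le[of "Pos ` V" "Neg ` V"] card_image_le[OF finite_V, of Pos]
      card_image_le[OF finite_V, of Neg] by linarith
  also have "\<dots> \<le> 2 ^ card V" by (rule double_le_power)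
  finally have card: "card C \<le> 2 ^ card V" .
  have "\<exists>b. reg_tree S V b \<and> num_nodes b \<le> 2 * d + 1 \<and> l \<in> root_clause b \<and>
      root_clause b \<subseteq> C \<union> {Pos q}" if "l \<in> C" for l
    using C_covered[OF that] source_block by blast
  then obtain b where b: "\<And>l. l \<in> C \<Longrightarrow> reg_tree S V (b l) \<and> num_nodes (b l) \<le> 2 * d + 1 \<and>
      l \<in> root_clause (b l) \<and> root_clause (b l) \<subseteq> C \<union> {Pos q}"
    by metis
  obtain ls where ls: "set ls = C" "distinct ls" using fin finite_distinct_list by blast
  have len: "length ls \<le> 2 ^ card V" using ls card distinct_card by fastforce
  let ?ts = "map b ls"
  have "reg_trees S V ?ts" by (rule reg_trees_of_reg_tree) (use b ls in auto)
  moreover have "reg_tree (S \<union> \<Union> (input_derived ` set ?ts)) V t"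
    by (rule reg_tree_mono[OF t(1)]) (use F_subset in auto)
  moreover have "C \<subseteq> \<Union> (root_clause ` set ?ts)" using b ls by auto
  moreover have "root_clause u \<subseteq> C \<union> {Pos q}" if "u \<in> set ?ts" for u using that b ls by auto
  ultimately have "\<exists>T. regWRTI_proof S T C \<and>
      num_nodes T \<le> (\<Sum>u\<leftarrow>?ts. num_nodes u + 1) + num_nodes t"
    using fresh var_of_C len t(2) unfolding fresh_vars_def
    by (intro finish_proof[where V = V and ps = ps and q = q]) auto
  then obtain T where T: "regWRTI_proof S T C"
      "num_nodes T \<le> (\<Sum>u\<leftarrow>?ts. num_nodes u + 1) + num_nodes t" by blast
  \<comment> \<open>Source blocks are two nodes smaller than the general bound. Over
    \<open>2 ^ card V\<close> blocks this saving pays for the search tree.\<close>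
  have "(\<Sum>u\<leftarrow>?ts. num_nodes u + 1) \<le> (\<Sum>u\<leftarrow>?ts. 2 * d + 2)"
    using b ls by (intro sum_list_mono) auto
  also have "\<dots> = length ls * (2 * d + 2)"
    by (simp only: sum_list_triv of_nat_id length_map)
  also have "\<dots> \<le> 2 ^ card V * (2 * d + 2)" using len by (rule mult_le_mono1)
  finally have "num_nodes T \<le> 2 ^ card V * (2 * d + 2) + 2 * 2 ^ card V" using T(2) t(3) by simp
  also have "\<dots> = 2 ^ card V * (2 * (d + 2))" by (simp add: algebra_simps)
  also have "\<dots> \<le> card N * (2 * (d + 2))" using assms by (intro mult_le_mono1) simp
  finally show ?thesis using T(1) by (intro exI[of _ T]) (simp add: algebra_simps)
qed

text \<open>Without complementary pairs a clause has at most one literal per variable; with them it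
  could have two.\<close>

lemma nontautological_card:
  assumes "v \<in> N" "\<not> tautological (cl v)"
  shows "card (cl v) \<le> card V"
proof -
  have "inj_on var_of (cl v)"
    using strippable_inj_on[of "{}" "cl v"] assms(2)
    by (auto simp: strippable_def tautological_def)
  then show ?thesis
    using var_of_literal[OF assms(1)] finite_V by (intro card_inj_on_le) auto
qed

end

section \<open>From graph proofs to the locale\<close>

lemma rd_proof_resolution_dag:
  assumes "rd_proof F G cl xv C"
  shows "resolution_dag F (verts G) (arcs_ends G) cl"
proof -
  interpret fin_digraph G using assms by (simp add: rd_proof_def)
  show ?thesis
  proof
    show "finite (verts G)" by (rule finite_verts)
    show "arcs_ends G \<subseteq> verts G \<times> verts G" using adj_in_verts by auto
    show "acyclic (arcs_ends G)" using assms by (simp add: rd_proof_def)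
    fix v assume v: "v \<in> verts G"
    show "cl v \<in> F \<or> (\<exists>x a b. (a, v) \<in> arcs_ends G \<and> (b, v) \<in> arcs_ends G \<and>
      Pos x \<in> cl a \<and> Neg x \<in> cl b \<and> cl v = (cl a - {Pos x}) \<union> (cl b - {Neg x}))"
    proof (cases "in_degree G v = 0")
      case True
      then show ?thesis using assms v by (auto simp: rd_proof_def)
    next
      case False
      then obtain a b where ab: "in_arcs G v = {a, b}"
          "resolvent (xv v) (cl (tail G a)) (cl (tail G b)) (cl v)"
        using assms v unfolding rd_proof_def by metis
      have "(tail G e, v) \<in> arcs_ends G" if "e \<in> {a, b}" for e
        using that ab(1) by (auto simp: in_arcs_def arcs_ends_def arc_to_ends_def)
      then show ?thesis using ab(2) unfolding resolvent_def by blast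
    qed
  qed
qed

theorem theorem7p3:
  fixes F :: "'v clause set" and C :: "'v clause"
    and q :: 'v and ps :: "'v list"
    and G :: "('n, 'a) pre_digraph" and cl :: "'n \<Rightarrow> 'v clause" and xv :: "'n \<Rightarrow> 'v"
    and n s d :: nat
  assumes "finite F" and "\<forall>E\<in>F. finite E \<and> \<not> tautological E"
    and "n = card (vars F)"
    and "fresh_vars F q ps"
    and "rd_proof F G cl xv C"
    and "s = card (verts G)"
    and "d = Max ((\<lambda>v. card (cl v)) ` verts G)"
  shows "(\<exists>T. regWRTI_proof (VE F q ps) T C \<and> num_nodes T \<le> 2 * s * (d + 2) + 1) \<and>
    ((\<forall>v\<in>verts G. \<not> tautological (cl v)) \<longrightarrow> d \<le> n)"
proof -
  interpret resolution_dag F "verts G" "arcs_ends G" cl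
    using assms(5) by (rule rd_proof_resolution_dag)
  obtain r where r: "r \<in> verts G" "cl r = C"
    using assms(5) unfolding rd_proof_def by blast
  interpret proof_setup F "verts G" "arcs_ends G" cl q ps r C d
    using assms r finite_nodes by unfold_locales (auto intro!: Max_ge)
  have "d \<in> (\<lambda>v. card (cl v)) ` verts G"
    unfolding assms(7) using finite_nodes r(1) by (intro Max_in) auto
  then have "(\<forall>v\<in>verts G. \<not> tautological (cl v)) \<longrightarrow> d \<le> n"
    using nontautological_card assms(3) by auto
  then show ?thesis
    unfolding assms(6) using few_nodes_proof many_nodes_proof by (meson not_le)
qed

end
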